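(* Let $(p_n)_{n\ge0}$ and $(q_n)_{n\ge0}$ be the sequences defined by $p_0=1$, $p_1=0$, $q_0=0$ and $$2p_{n+1}=(3n+3)q_n-2(3n+1)p_n+2p_{n-1}\quad(n\ge1),\qquad q_n=(3n+2)p_n+2q_{n-1}\quad(n\ge1).$$ Then for every $n\ge0$, $p_n$ equals the number of ordered Carlitz words of $1^3,2^3,\ldots,n^3$, and $q_n$ equals the number of ordered Carlitz words of $0^2,1^3,2^3,\ldots,n^3$.
   Context: A word of $1^3,\ldots,n^3$ is a sequence of length $3n$ in which each of $1,\ldots,n$ occurs exactly three times; a word of $0^2,1^3,\ldots,n^3$ is a sequence of length $3n+2$ in which $0$ occurs exactly twice and each of $1,\ldots,n$ occurs exactly three times. A word is Carlitz if no two adjacent entries are equal. It is ordered if the first occurrences of the symbols present appear in increasing order from left to right (for words containing $0$, this means the word begins with $0$ and the first occurrences of $1,2,\ldots,n$ appear in increasing order). For $n=0$ the words are the empty word (for $p_0$) and $00$ (not Carlitz, so $q_0=0$). *)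

theory Defs
  imports Complex_Main
begin

definition cubic_words :: "nat \<Rightarrow> nat list set" where
  "cubic_words n = {w. length w = 3 * n \<and> (\<forall>i\<in>{1..n}. count_list w i = 3)}"

definition cubic_words0 :: "nat \<Rightarrow> nat list set" where
  "cubic_words0 n = {w. length w = 3 * n + 2 \<and> count_list w 0 = 2 \<and>
     (\<forall>i\<in>{1..n}. count_list w i = 3)}"

abbreviation carlitz :: "'a list \<Rightarrow> bool" where
  "carlitz w \<equiv> distinct_adj w"

definition first_occ :: "'a list \<Rightarrow> 'a \<Rightarrow> nat" where
  "first_occ w a = (LEAST i. i < length w \<and> w ! i = a)"

(* Only symbols that occur are compared; first_occ is unspecified for the others.
   For a word over the naturals containing 0 this forces the word to begin with 0. *)
definition ordered_word :: "'a::linorder list \<Rightarrow> bool" where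
  "ordered_word w \<longleftrightarrow>
     (\<forall>a\<in>set w. \<forall>b\<in>set w. a < b \<longrightarrow> first_occ w a < first_occ w b)"

end

theory Submission
  imports Defs "HOL-Computational_Algebra.Polynomial"
begin

text \<open>
  Let \<open>\<Phi>\<close> be the linear functional with \<open>\<Phi>(x^j) = j!\<close>, so that
  \<open>\<Phi>(g) = g(0) + \<Phi>(g')\<close>. Give a letter that still has to occur \<open>m\<close> times the weight
  \<open>L\<^sub>m\<close>, where \<open>L\<^sub>0 = 1\<close>, \<open>L\<^sub>m(0) = 0\<close> for \<open>m > 0\<close> and
  \<open>L\<^sub>m\<^sub>+\<^sub>1' = L\<^sub>m - L\<^sub>m'\<close>. Removing the first letter of a Carlitz word shows that \<open>\<Phi>\<close> of
  the product of the weights counts the words, and that replacing the weight of one letter by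
  its derivative counts the words starting with that letter: the product rule sums over the
  choices of the first letter. With \<open>c\<close> fresh letters in prescribed order, only one of them may
  come next, and this accounts for a factor \<open>1/c!\<close>.

  Hence, with \<open>f = L\<^sub>3 = x^3/6 - x^2 + x\<close>, the two counts are \<open>\<Phi>(f^n)/n!\<close> and
  \<open>\<Phi>((x - 1) f^n)/n!\<close>, and both recurrences are instances of \<open>\<Phi>(g) = \<Phi>(g')\<close>
  for a suitable multiple \<open>g\<close> of a power of \<open>f\<close>.
\<close>

section \<open>The factorial functional and the letter weights\<close>

definition fact_functional :: "real poly \<Rightarrow> real" where
  "fact_functional p = (\<Sum>i\<le>degree p. coeff p i * fact i)"

text \<open>A common upper limit of summation lets polynomials of different degrees be added
  termwise.\<close>

lemma fact_functional_eq_sum: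
  assumes "degree p \<le> d"
  shows "fact_functional p = (\<Sum>i\<le>d. coeff p i * fact i)"
  unfolding fact_functional_def
  using assms by (intro sum.mono_neutral_left) (auto simp: coeff_eq_0)

lemma fact_functional_0 [simp]: "fact_functional 0 = 0"
  by (simp add: fact_functional_def)

lemma fact_functional_1 [simp]: "fact_functional 1 = 1"
  by (simp add: fact_functional_def)

lemma fact_functional_add: "fact_functional (p + q) = fact_functional p + fact_functional q"
proof -
  define d where "d = max (degree p) (degree q)"
  have "degree (p + q) \<le> d" "degree p \<le> d" "degree q \<le> d"
    by (auto simp: d_def degree_add_le)
  thus ?thesis
    by (simp add: fact_functional_eq_sum[where d = d] sum.distrib algebra_simps)
qed

lemma fact_functional_smult: "fact_functional (smult c p) = c * fact_functional p"
  using fact_functional_eq_sum[of "smult c p" "degree p"]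
  by (simp add: degree_smult_le fact_functional_def sum_distrib_left mult.assoc)

lemma fact_functional_diff: "fact_functional (p - q) = fact_functional p - fact_functional q"
  using fact_functional_add[of p "smult (-1) q"] by (simp only: fact_functional_smult) simp

lemma fact_functional_sum: "fact_functional (sum f A) = (\<Sum>x\<in>A. fact_functional (f x))"
  by (induction A rule: infinite_finite_induct) (auto simp: fact_functional_add)

text \<open>Integration by parts, as \<open>fact_functional p\<close> is the integral of
  \<open>p(x) exp(-x)\<close> over the positive reals.\<close>
lemma fact_functional_pderiv: "fact_functional p = poly p 0 + fact_functional (pderiv p)"
proof -
  have "fact_functional p = (\<Sum>i\<le>Suc (degree p). coeff p i * fact i)"
    by (rule fact_functional_eq_sum) simp
  also have "\<dots> = coeff p 0 + (\<Sum>i\<le>degree p. coeff p (Suc i) * fact (Suc i))"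
    by (subst sum.atMost_Suc_shift) simp
  also have "(\<Sum>i\<le>degree p. coeff p (Suc i) * fact (Suc i)) = fact_functional (pderiv p)"
    by (subst fact_functional_eq_sum[where d = "degree p"])
       (auto simp: coeff_pderiv degree_pderiv algebra_simps intro!: sum.cong)
  finally show ?thesis by (simp add: poly_0_coeff_0)
qed

text \<open>The generalized Laguerre polynomials, up to sign, encoding a letter of multiplicity
  \<open>m \<le> 3\<close>: the coefficient of \<open>x^j/j!\<close> is the signed number of compositions
  of \<open>m\<close> into \<open>j\<close> parts. Values for \<open>m > 3\<close> are junk.\<close>
definition lag :: "nat \<Rightarrow> real poly" where
  "lag m = (if m = 0 then 1 else if m = 1 then [:0, 1:]
            else if m = 2 then [:0, -1, 1/2:] else [:0, 1, -1, 1/6:])"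

lemma lag_0 [simp]: "lag 0 = 1"
  by (simp add: lag_def)

lemma poly_lag_0: "m > 0 \<Longrightarrow> poly (lag m) 0 = 0"
  by (simp add: lag_def)

text \<open>Differentiation thereby models choosing a letter: one copy is used, and the
  continuations that begin with the same letter again are subtracted. At \<open>m = 3\<close> the
  relation fails, as \<open>lag\<close> is constant from 3 on.\<close>

lemma pderiv_lag_Suc:
  assumes "m < 3"
  shows "pderiv (lag (Suc m)) = lag m - pderiv (lag m)"
proof -
  have "m = 0 \<or> m = 1 \<or> m = 2" using assms by auto
  thus ?thesis by (auto simp: lag_def pderiv_pCons one_pCons)
qed

section \<open>Suffixes of ordered Carlitz words and their first letters\<close>

text \<open>In a suffix, letters below \<open>k\<close> have occurred before, so their order is
  free. The case \<open>k = 0\<close> is \<open>ordered_word\<close>.\<close>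

definition ordered_from :: "nat \<Rightarrow> nat list \<Rightarrow> bool" where
  "ordered_from k w \<longleftrightarrow>
     (\<forall>a\<in>set w. \<forall>b\<in>set w. k \<le> a \<longrightarrow> a < b \<longrightarrow> first_occ w a < first_occ w b)"

lemma first_occ_Cons_same [simp]: "first_occ (a # w) a = 0"
  unfolding first_occ_def by (rule Least_equality) auto

lemma first_occ_Cons_other:
  assumes "b \<in> set w" "b \<noteq> a"
  shows "first_occ (a # w) b = Suc (first_occ w b)"
proof -
  obtain i where "i < length w" "w ! i = b"
    using assms by (auto simp: in_set_conv_nth)
  hence "first_occ (a # w) b = Suc (LEAST i. Suc i < length (a # w) \<and> (a # w) ! Suc i = b)"
    unfolding first_occ_def using assms by (intro Least_Suc[where n = "Suc i"]) auto
  thus ?thesis by (simp add: first_occ_def)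
qed

text \<open>Only letters from \<open>k\<close> on are compared, and a smaller letter in front shifts
  all their first occurrences by one.\<close>

lemma ordered_from_Cons_seen:
  assumes "a < k"
  shows "ordered_from k (a # w) \<longleftrightarrow> ordered_from k w"
  using assms by (auto simp: ordered_from_def first_occ_Cons_other)

lemma ordered_from_Cons_new: "ordered_from k (k # w) \<longleftrightarrow> ordered_from (Suc k) w"
proof
  assume *: "ordered_from k (k # w)"
  show "ordered_from (Suc k) w"
    unfolding ordered_from_def
  proof (intro ballI impI)
    fix a b assume ab: "a \<in> set w" "b \<in> set w" "Suc k \<le> a" "a < b"
    hence "first_occ (k # w) a < first_occ (k # w) b"
      using * unfolding ordered_from_def by auto
    thus "first_occ w a < first_occ w b"
      using ab by (simp add: first_occ_Cons_other)
  qed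
next
  assume *: "ordered_from (Suc k) w"
  show "ordered_from k (k # w)"
    unfolding ordered_from_def
  proof (intro ballI impI)
    fix a b assume ab: "a \<in> set (k # w)" "b \<in> set (k # w)" "k \<le> a" "a < b"
    show "first_occ (k # w) a < first_occ (k # w) b"
      using ab * by (cases "a = k") (auto simp: ordered_from_def first_occ_Cons_other)
  qed
qed

text \<open>If \<open>k < a\<close>, then \<open>k\<close> would have to occur before position 0.
  Hence fresh letters can only enter in increasing order.\<close>

lemma ordered_from_Cons_le:
  assumes "ordered_from k (a # w)" "k \<in> set (a # w)"
  shows "a \<le> k"
  using assms by (force simp: ordered_from_def)

text \<open>The letters below \<open>k\<close> have already been seen and must still occur \<open>m i\<close>
  times; the letters \<open>k, \<dots>, N - 1\<close> are fresh.\<close>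
definition mults :: "(nat \<Rightarrow> nat) \<Rightarrow> nat \<Rightarrow> nat \<Rightarrow> nat \<Rightarrow> nat" where
  "mults m k N i = (if i < k then m i else if i < N then 3 else 0)"

definition tails :: "(nat \<Rightarrow> nat) \<Rightarrow> nat \<Rightarrow> nat \<Rightarrow> nat list set" where
  "tails m k N = {w. carlitz w \<and> ordered_from k w \<and> (\<forall>i. count_list w i = mults m k N i)}"

definition tails_from :: "(nat \<Rightarrow> nat) \<Rightarrow> nat \<Rightarrow> nat \<Rightarrow> nat \<Rightarrow> nat list set" where
  "tails_from m k N a = {w \<in> tails m k N. w \<noteq> [] \<and> hd w = a}"

lemma tails_from_subset: "tails_from m k N a \<subseteq> tails m k N"
  by (auto simp: tails_from_def)

text \<open>The set difference discards the remainders that start with \<open>a\<close> again, which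
  is the Carlitz condition at the cut. The guard \<open>m a > 0\<close> excludes truncated
  subtraction.\<close>

lemma Cons_in_tails_seen:
  assumes "a < k"
  shows "a # w \<in> tails m k N \<longleftrightarrow>
           m a > 0 \<and> w \<in> tails (m(a := m a - 1)) k N - tails_from (m(a := m a - 1)) k N a"
proof -
  have "(\<forall>i. count_list (a # w) i = mults m k N i) \<longleftrightarrow>
        m a > 0 \<and> (\<forall>i. count_list w i = mults (m(a := m a - 1)) k N i)"
    (is "(\<forall>i. ?P i) \<longleftrightarrow> _ \<and> (\<forall>i. ?Q i)")
  proof -
    have "?P i \<longleftrightarrow> ?Q i" if "m a > 0" for i
      using assms that by (cases "i = a") (auto simp: mults_def)
    moreover have "\<not> ?P a" if "m a = 0"
      using assms that by (simp add: mults_def)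
    ultimately show ?thesis by blast
  qed
  thus ?thesis using assms
    by (auto simp: tails_def tails_from_def ordered_from_Cons_seen distinct_adj_Cons)
qed

text \<open>The letter \<open>k\<close> becomes a seen letter with two of its three copies
  left.\<close>

lemma Cons_in_tails_new:
  assumes "k < N"
  shows "k # w \<in> tails m k N \<longleftrightarrow>
           w \<in> tails (m(k := 2)) (Suc k) N - tails_from (m(k := 2)) (Suc k) N k"
proof -
  have "(\<forall>i. count_list (k # w) i = mults m k N i) \<longleftrightarrow>
        (\<forall>i. count_list w i = mults (m(k := 2)) (Suc k) N i)"
    (is "(\<forall>i. ?P i) \<longleftrightarrow> (\<forall>i. ?Q i)")
  proof -
    have "?P i \<longleftrightarrow> ?Q i" for i
      using assms by (cases "i = k") (auto simp: mults_def)
    thus ?thesis by blast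
  qed
  thus ?thesis
    by (auto simp: tails_def tails_from_def ordered_from_Cons_new distinct_adj_Cons)
qed

lemma hd_in_tails_le:
  assumes "a # w \<in> tails m k N" "k \<le> N"
  shows "a < k \<or> a = k \<and> k < N"
proof (rule ccontr)
  assume *: "\<not> ?thesis"
  have cnt: "count_list (a # w) i = mults m k N i" for i
    using assms by (auto simp: tails_def)
  from cnt[of a] have "mults m k N a > 0" by auto
  with * have "k < a" "k < N" by (auto simp: mults_def split: if_splits)
  hence "count_list (a # w) k \<noteq> 0" by (subst cnt) (simp add: mults_def)
  hence "k \<in> set (a # w)" by (metis count_list_0_iff)
  with assms have "a \<le> k" by (intro ordered_from_Cons_le[of k a w]) (auto simp: tails_def)
  with \<open>k < a\<close> show False by simp
qed

lemma tails_from_seen: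
  assumes "a < k"
  shows "tails_from m k N a = (if m a = 0 then {} else
           (#) a ` (tails (m(a := m a - 1)) k N - tails_from (m(a := m a - 1)) k N a))"
    (is "_ = ?R")
proof (intro set_eqI)
  fix w show "w \<in> tails_from m k N a \<longleftrightarrow> w \<in> ?R"
    using Cons_in_tails_seen[OF assms] by (cases w) (auto simp: tails_from_def)
qed

lemma tails_from_new:
  assumes "k < N"
  shows "tails_from m k N k =
           (#) k ` (tails (m(k := 2)) (Suc k) N - tails_from (m(k := 2)) (Suc k) N k)"
    (is "_ = ?R")
proof (intro set_eqI)
  fix w show "w \<in> tails_from m k N k \<longleftrightarrow> w \<in> ?R"
    using Cons_in_tails_new[OF assms] by (cases w) (auto simp: tails_from_def)
qed

text \<open>The positive quantity is the length of the words, so each of them has a first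
  letter.\<close>

lemma tails_split:
  assumes "k \<le> N" "(\<Sum>i<k. m i) + 3 * (N - k) > 0"
  shows "tails m k N = (\<Union>a<k. tails_from m k N a) \<union> (if k < N then tails_from m k N k else {})"
proof -
  have "[] \<notin> tails m k N"
  proof
    assume "[] \<in> tails m k N"
    hence *: "mults m k N i = 0" for i by (simp add: tails_def)
    have "m i = 0" if "i < k" for i using *[of i] that by (simp add: mults_def)
    moreover have "\<not> k < N" using *[of k] by (auto simp: mults_def)
    ultimately show False using assms by simp
  qed
  show ?thesis
  proof (intro set_eqI)
    fix w
    show "w \<in> tails m k N \<longleftrightarrow>
      w \<in> (\<Union>a<k. tails_from m k N a) \<union> (if k < N then tails_from m k N k else {})"
      using \<open>[] \<notin> tails m k N\<close> hd_in_tails_le[OF _ assms(1)]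
      by (cases w) (auto simp: tails_from_def)
  qed
qed

section \<open>Counting suffixes by the functional\<close>

definition tails_poly :: "(nat \<Rightarrow> nat) \<Rightarrow> nat \<Rightarrow> nat \<Rightarrow> real poly" where
  "tails_poly m k N = (\<Prod>i<k. lag (m i)) * lag 3 ^ (N - k)"

text \<open>Induction on the remaining length. The counts by first letter are carried along because
  removing \<open>a\<close> leaves all shorter suffixes except those that start with
  \<open>a\<close>.\<close>

lemma card_tails_aux:
  assumes "k \<le> N" "\<forall>i<k. m i \<le> 3"
  shows "finite (tails m k N) \<and>
         real (card (tails m k N)) = fact_functional (tails_poly m k N) / fact (N - k) \<and>
         (\<forall>a<k. real (card (tails_from m k N a)) =
            fact_functional (pderiv (lag (m a)) * (\<Prod>i\<in>{..<k} - {a}. lag (m i)) * lag 3 ^ (N - k)) / fact (N - k))"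
  using assms
proof (induction "(\<Sum>i<k. m i) + 3 * (N - k)" arbitrary: m k rule: less_induct)
  case less
  define R where "R = (\<lambda>a. (\<Prod>i\<in>{..<k} - {a}. lag (m i)))"
  have seen: "finite (tails_from m k N a) \<and> real (card (tails_from m k N a)) =
      fact_functional (pderiv (lag (m a)) * R a * lag 3 ^ (N - k)) / fact (N - k)" if a: "a < k" for a
  proof (cases "m a = 0")
    case True
    thus ?thesis using a by (simp add: tails_from_seen)
  next
    case False
    define m' where "m' = m(a := m a - 1)"
    have sums: "(\<Sum>i<k. m i) = m a + (\<Sum>i\<in>{..<k} - {a}. m i)"
               "(\<Sum>i<k. m' i) = m' a + (\<Sum>i\<in>{..<k} - {a}. m' i)"
      using a by (auto intro!: sum.remove)
    have "(\<Sum>i\<in>{..<k} - {a}. m' i) = (\<Sum>i\<in>{..<k} - {a}. m i)"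
      by (intro sum.cong) (auto simp: m'_def)
    with sums have "(\<Sum>i<k. m' i) + 3 * (N - k) < (\<Sum>i<k. m i) + 3 * (N - k)"
      using False by (simp add: m'_def)
    note IH = less.hyps[OF this less.prems(1)]
    have Req: "(\<Prod>i\<in>{..<k} - {a}. lag (m' i)) = R a"
      unfolding R_def by (intro prod.cong) (auto simp: m'_def)
    have le: "\<forall>i<k. m' i \<le> 3" using less.prems(2) by (auto simp: m'_def intro: le_trans[OF diff_le_self])
    have fin: "finite (tails m' k N)" using IH le by blast
    have poly: "tails_poly m' k N = lag (m' a) * R a * lag 3 ^ (N - k)"
      unfolding tails_poly_def Req[symmetric] using a by (subst prod.remove[of _ a]) auto
    have eq: "tails_from m k N a = (#) a ` (tails m' k N - tails_from m' k N a)"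
      using a False by (simp add: tails_from_seen m'_def)
    have "real (card (tails_from m k N a)) = real (card (tails m' k N)) - real (card (tails_from m' k N a))"
      unfolding eq using fin
      by (simp add: card_image card_Diff_subset[OF finite_subset[OF tails_from_subset]]
            tails_from_subset card_mono of_nat_diff)
    also have "\<dots> = fact_functional ((lag (m' a) - pderiv (lag (m' a))) * R a * lag 3 ^ (N - k)) / fact (N - k)"
      using IH le a Req poly by (simp add: left_diff_distrib fact_functional_diff diff_divide_distrib)
    also have "lag (m' a) - pderiv (lag (m' a)) = pderiv (lag (m a))"
      using pderiv_lag_Suc[of "m' a"] False less.prems(2) a
      by (force simp: m'_def)
    finally show ?thesis using fin eq by simp
  qed
  \<comment> \<open>Among the fresh letters only \<open>k\<close> may come first, and
    \<open>N - k - 1\<close> letters stay fresh; hence the smaller factorial.\<close>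
  have new: "finite (tails_from m k N k) \<and> real (card (tails_from m k N k)) =
      fact_functional ((\<Prod>i<k. lag (m i)) * pderiv (lag 3) * lag 3 ^ (N - k - 1)) / fact (N - k - 1)"
    if k: "k < N"
  proof -
    define m' where "m' = m(k := 2)"
    have "(\<Sum>i<k. m' i) = (\<Sum>i<k. m i)"
      by (intro sum.cong) (auto simp: m'_def)
    hence "(\<Sum>i<Suc k. m' i) + 3 * (N - Suc k) < (\<Sum>i<k. m i) + 3 * (N - k)"
      using k by (simp add: m'_def)
    note IH' = less.hyps[OF this]
    have "\<forall>i<Suc k. m' i \<le> 3" using less.prems(2) by (auto simp: m'_def)
    with IH' k have IH: "finite (tails m' (Suc k) N)"
         "real (card (tails m' (Suc k) N)) =
            fact_functional (tails_poly m' (Suc k) N) / fact (N - Suc k)"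
         "real (card (tails_from m' (Suc k) N k)) =
            fact_functional (pderiv (lag (m' k)) * (\<Prod>i\<in>{..<Suc k} - {k}. lag (m' i)) * lag 3 ^ (N - Suc k)) / fact (N - Suc k)"
      by (auto simp del: lessThan_Suc)
    have Req: "(\<Prod>i<k. lag (m' i)) = (\<Prod>i<k. lag (m i))"
      by (intro prod.cong) (auto simp: m'_def)
    have set_eq: "{..<Suc k} - {k} = {..<k}" by auto
    have eq: "tails_from m k N k = (#) k ` (tails m' (Suc k) N - tails_from m' (Suc k) N k)"
      using k by (simp add: tails_from_new m'_def)
    have "real (card (tails_from m k N k)) =
            real (card (tails m' (Suc k) N)) - real (card (tails_from m' (Suc k) N k))"
      unfolding eq using IH(1)
      by (simp add: card_image card_Diff_subset[OF finite_subset[OF tails_from_subset]]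
            tails_from_subset card_mono of_nat_diff)
    also have "\<dots> = fact_functional ((\<Prod>i<k. lag (m i)) * (lag (m' k) - pderiv (lag (m' k))) * lag 3 ^ (N - Suc k))
         / fact (N - Suc k)"
      unfolding IH(2,3) set_eq Req
      by (simp add: tails_poly_def Req algebra_simps fact_functional_diff diff_divide_distrib)
    also have "lag (m' k) - pderiv (lag (m' k)) = pderiv (lag 3)"
      using pderiv_lag_Suc[of 2] by (simp add: m'_def numeral_3_eq_3)
    finally show ?thesis using IH(1) eq by simp
  qed
  have all: "finite (tails m k N) \<and>
         real (card (tails m k N)) = fact_functional (tails_poly m k N) / fact (N - k)"
  proof (cases "(\<Sum>i<k. m i) + 3 * (N - k) = 0")
    case True
    hence "mults m k N i = 0" for i by (auto simp: mults_def)
    hence "tails m k N = {[]}"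
      by (auto simp: tails_def ordered_from_def count_list_0_iff)
    thus ?thesis using True by (simp add: tails_poly_def)
  next
    case False
    hence split: "tails m k N =
        (\<Union>a<k. tails_from m k N a) \<union> (if k < N then tails_from m k N k else {})"
      using less.prems by (intro tails_split) (simp_all only: neq0_conv)
    let ?T = "if k < N then tails_from m k N k else {}"
    have "finite (tails m k N)" unfolding split using seen new by auto
    have "card (tails m k N) = card (\<Union>a<k. tails_from m k N a) + card ?T"
      unfolding split using seen new
      by (intro card_Un_disjoint) (auto simp: tails_from_def)
    also have "card (\<Union>a<k. tails_from m k N a) = (\<Sum>a<k. card (tails_from m k N a))"
      using seen by (intro card_UN_disjoint) (auto simp: tails_from_def)
    finally have "real (card (tails m k N)) =
        (\<Sum>a<k. real (card (tails_from m k N a))) + real (card ?T)" by simp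
    also have "(\<Sum>a<k. real (card (tails_from m k N a))) =
        fact_functional (pderiv (\<Prod>i<k. lag (m i)) * lag 3 ^ (N - k)) / fact (N - k)"
      using seen by (simp add: pderiv_prod sum_distrib_left fact_functional_sum sum_divide_distrib
          R_def mult.commute)
    also have "real (card ?T) =
        fact_functional ((\<Prod>i<k. lag (m i)) * pderiv (lag 3 ^ (N - k))) / fact (N - k)"
    proof (cases "k < N")
      case True
      then obtain d where d: "N - k = Suc d" by (metis Suc_diff_Suc)
      \<comment> \<open>The power rule contributes the factor \<open>N - k\<close>, which reconciles
        the factorials of \<open>N - k - 1\<close> and \<open>N - k\<close>.\<close>
      have "(\<Prod>i<k. lag (m i)) * pderiv (lag 3 ^ (N - k)) =
            smult (real (Suc d)) ((\<Prod>i<k. lag (m i)) * pderiv (lag 3) * lag 3 ^ (N - k - 1))"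
        unfolding d by (simp only: pderiv_power_Suc) (simp add: mult_ac)
      thus ?thesis using True new d by (simp add: fact_functional_smult del: of_nat_Suc)
    qed auto
    also have "fact_functional (pderiv (\<Prod>i<k. lag (m i)) * lag 3 ^ (N - k)) / fact (N - k) +
        fact_functional ((\<Prod>i<k. lag (m i)) * pderiv (lag 3 ^ (N - k))) / fact (N - k) =
        fact_functional (pderiv (tails_poly m k N)) / fact (N - k)"
      by (simp add: tails_poly_def pderiv_mult fact_functional_add add_divide_distrib algebra_simps)
    also have "fact_functional (pderiv (tails_poly m k N)) = fact_functional (tails_poly m k N)"
    proof -
      \<comment> \<open>Some letter is left, and its weight vanishes at 0, so there is no boundary
        term.\<close>
      have "(\<exists>i<k. m i > 0) \<or> N - k > 0" using False by auto
      hence "poly (tails_poly m k N) 0 = 0"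
        by (force simp: tails_poly_def poly_prod poly_lag_0)
      thus ?thesis using fact_functional_pderiv[of "tails_poly m k N"] by simp
    qed
    finally show ?thesis using \<open>finite (tails m k N)\<close> by simp
  qed
  show ?case using all seen by (simp add: R_def)
qed

lemma card_tails:
  assumes "k \<le> N" "\<And>i. i < k \<Longrightarrow> m i \<le> 3"
  shows "real (card (tails m k N)) = fact_functional (tails_poly m k N) / fact (N - k)"
  using card_tails_aux[of k N m] assms by blast

lemma card_tails_from:
  assumes "k \<le> N" "\<And>i. i < k \<Longrightarrow> m i \<le> 3" "a < k"
  shows "real (card (tails_from m k N a)) =
    fact_functional (pderiv (lag (m a)) * (\<Prod>i\<in>{..<k} - {a}. lag (m i)) * lag 3 ^ (N - k)) / fact (N - k)"
  using card_tails_aux[of k N m] assms by blast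

section \<open>The two families of words as sets of suffixes\<close>

text \<open>The letters of \<open>A\<close> already fill the whole length.\<close>

lemma count_list_outside:
  assumes "finite A" "length w = (\<Sum>x\<in>A. count_list w x)" "x \<notin> A"
  shows "count_list w x = 0"
proof -
  have "length w = (\<Sum>y\<in>set w \<union> A. count_list w y)"
    using assms(1) by (intro sum_count_set[symmetric]) auto
  also have "\<dots> = (\<Sum>y\<in>A. count_list w y) + (\<Sum>y\<in>set w - A. count_list w y)"
    using assms(1) by (subst sum.union_disjoint[symmetric]) (auto intro: sum.cong)
  finally have "(\<Sum>y\<in>set w - A. count_list w y) = 0" using assms(2) by simp
  thus ?thesis using assms(3) by (cases "x \<in> set w") (auto simp: count_list_0_iff)
qed

text \<open>The letter 0 is declared seen with no copies left, so that the fresh letters are exactly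
  \<open>1, ..., n\<close>.\<close>

lemma cubic_words_eq_tails:
  "{w \<in> cubic_words n. carlitz w \<and> ordered_word w} = tails (\<lambda>_. 0) 1 (Suc n)"
proof -
  have "w \<in> cubic_words n \<longleftrightarrow> (\<forall>i. count_list w i = mults (\<lambda>_. 0) 1 (Suc n) i)" for w
  proof
    assume w: "w \<in> cubic_words n"
    hence "length w = (\<Sum>x\<in>{1..n}. count_list w x)" by (simp add: cubic_words_def)
    from count_list_outside[OF _ this] w
    show "\<forall>i. count_list w i = mults (\<lambda>_. 0) 1 (Suc n) i"
      by (auto simp: mults_def cubic_words_def)
  next
    assume w: "\<forall>i. count_list w i = mults (\<lambda>_. 0) 1 (Suc n) i"
    have "set w \<subseteq> {1..n}"
    proof
      fix x assume "x \<in> set w"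
      hence "count_list w x \<noteq> 0" by (simp add: count_list_0_iff)
      thus "x \<in> {1..n}" using w by (auto simp: mults_def split: if_splits)
    qed
    hence "length w = (\<Sum>x\<in>{1..n}. count_list w x)" by (simp add: sum_count_set)
    thus "w \<in> cubic_words n" using w by (simp add: mults_def cubic_words_def)
  qed
  moreover have "ordered_word w \<longleftrightarrow> ordered_from 1 w"
    if "\<forall>i. count_list w i = mults (\<lambda>_. 0) 1 (Suc n) i" for w
  proof -
    have "count_list w 0 = 0" using that by (simp add: mults_def)
    hence "0 \<notin> set w" by (simp add: count_list_0_iff)
    thus ?thesis by (auto simp: ordered_word_def ordered_from_def Suc_le_eq intro: gr0I)
  qed
  ultimately show ?thesis by (auto simp: tails_def)
qed

text \<open>Since 0 occurs, orderedness forces it to the front. Standing there it precedes all other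
  letters, so it may be declared seen; the multiplicity 2 includes the front copy.\<close>

lemma cubic_words0_eq_tails_from:
  "{w \<in> cubic_words0 n. carlitz w \<and> ordered_word w} = tails_from (\<lambda>_. 2) 1 (Suc n) 0"
proof -
  have "w \<in> cubic_words0 n \<longleftrightarrow> (\<forall>i. count_list w i = mults (\<lambda>_. 2) 1 (Suc n) i)" for w
  proof
    assume w: "w \<in> cubic_words0 n"
    hence "length w = (\<Sum>x\<in>insert 0 {1..n}. count_list w x)" by (simp add: cubic_words0_def)
    from count_list_outside[OF _ this] w
    show "\<forall>i. count_list w i = mults (\<lambda>_. 2) 1 (Suc n) i"
      by (auto simp: mults_def cubic_words0_def)
  next
    assume w: "\<forall>i. count_list w i = mults (\<lambda>_. 2) 1 (Suc n) i"
    have "set w \<subseteq> insert 0 {1..n}"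
    proof
      fix x assume "x \<in> set w"
      hence "count_list w x \<noteq> 0" by (simp add: count_list_0_iff)
      thus "x \<in> insert 0 {1..n}" using w by (auto simp: mults_def split: if_splits)
    qed
    hence "length w = (\<Sum>x\<in>insert 0 {1..n}. count_list w x)"
      by (intro sum_count_set[symmetric]) auto
    thus "w \<in> cubic_words0 n" using w by (simp add: mults_def cubic_words0_def)
  qed
  moreover have "ordered_word w \<longleftrightarrow> ordered_from 1 w \<and> w \<noteq> [] \<and> hd w = 0"
    if "\<forall>i. count_list w i = mults (\<lambda>_. 2) 1 (Suc n) i" for w
  proof -
    have "count_list w 0 \<noteq> 0" using that by (simp add: mults_def)
    hence "0 \<in> set w" by (metis count_list_0_iff)
    then obtain a v where w: "w = a # v" by (cases w) auto
    have ow: "ordered_word w \<longleftrightarrow> ordered_from 0 w"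
      by (simp add: ordered_word_def ordered_from_def)
    have "a = 0" if "ordered_from 0 w"
      using ordered_from_Cons_le[of 0 a v] that \<open>0 \<in> set w\<close> w by simp
    moreover have "ordered_from 0 (0 # v) \<longleftrightarrow> ordered_from 1 (0 # v)"
      by (simp add: ordered_from_Cons_new ordered_from_Cons_seen)
    ultimately show ?thesis using w ow by auto
  qed
  ultimately show ?thesis by (auto simp: tails_def tails_from_def)
qed

lemma card_ordered_cubic_words:
  "real (card {w \<in> cubic_words n. carlitz w \<and> ordered_word w}) =
     fact_functional (lag 3 ^ n) / fact n"
  using card_tails[of 1 "Suc n" "\<lambda>_. 0"] by (simp add: cubic_words_eq_tails tails_poly_def)

text \<open>The letter 0 has weight \<open>lag 2\<close>, and starting with it replaces this weight
  by its derivative \<open>x - 1\<close>.\<close>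

lemma card_ordered_cubic_words0:
  "real (card {w \<in> cubic_words0 n. carlitz w \<and> ordered_word w}) =
     fact_functional ([:-1, 1:] * lag 3 ^ n) / fact n"
proof -
  have "pderiv (lag 2) = [:-1, 1:]" by (simp add: lag_def pderiv_pCons)
  thus ?thesis
    using card_tails_from[of 1 "Suc n" "\<lambda>_. 2" 0]
    by (simp add: cubic_words0_eq_tails_from lessThan_Suc)
qed

section \<open>Recurrences from integration by parts\<close>

text \<open>The boundary term vanishes with \<open>lag 3\<close> at 0. Factoring out
  \<open>lag 3 ^ n\<close> reduces each recurrence to an identity between polynomials of fixed
  degree.\<close>

lemma fact_functional_pderiv_mult_lag3_power:
  "fact_functional (r * lag 3 ^ Suc n) =
     fact_functional ((pderiv r * lag 3 + smult (real (Suc n)) (r * pderiv (lag 3))) * lag 3 ^ n)"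
proof -
  have "pderiv (r * lag 3 ^ Suc n) =
      (pderiv r * lag 3 + smult (real (Suc n)) (r * pderiv (lag 3))) * lag 3 ^ n"
    by (simp only: pderiv_mult pderiv_power_Suc) (simp add: algebra_simps)
  thus ?thesis
    using fact_functional_pderiv[of "r * lag 3 ^ Suc n"] by (simp add: poly_lag_0)
qed

text \<open>With \<open>f = lag 3\<close>, the source is
  \<open>(x - 2) f' = 3 f + 2 (x - 1)\<close>. The result is the recurrence for \<open>q\<close> at
  index \<open>n + 1\<close>, multiplied by the factorial of \<open>n + 1\<close>.\<close>

lemma fact_functional_recurrence_q:
  "fact_functional ([:-1, 1:] * lag 3 ^ Suc n) =
     (3 * real (Suc n) + 2) * fact_functional (lag 3 ^ Suc n)
     + 2 * real (Suc n) * fact_functional ([:-1, 1:] * lag 3 ^ n)"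
proof -
  let ?c = "real (Suc n)"
  have "pderiv [:-2, 1:] * lag 3 + smult ?c ([:-2, 1:] * pderiv (lag 3)) =
        smult (1 + 3 * ?c) (lag 3) + smult (2 * ?c) [:-1, 1:]"
    by (simp add: lag_def pderiv_pCons field_simps)
  hence "fact_functional ([:-2, 1:] * lag 3 ^ Suc n) =
         fact_functional ((smult (1 + 3 * ?c) (lag 3) + smult (2 * ?c) [:-1, 1:]) * lag 3 ^ n)"
    by (simp only: fact_functional_pderiv_mult_lag3_power)
  also have "\<dots> = fact_functional (smult (1 + 3 * ?c) (lag 3 ^ Suc n)
                                 + smult (2 * ?c) ([:-1, 1:] * lag 3 ^ n))"
    by (simp only: distrib_right mult_smult_left power_Suc)
  finally have "fact_functional ([:-2, 1:] * lag 3 ^ Suc n) =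
      (1 + 3 * ?c) * fact_functional (lag 3 ^ Suc n)
      + 2 * ?c * fact_functional ([:-1, 1:] * lag 3 ^ n)"
    by (simp only: fact_functional_add fact_functional_smult)
  \<comment> \<open>Passing from \<open>x - 2\<close> to \<open>x - 1\<close> raises the coefficient
    \<open>1 + 3 * ?c\<close> to \<open>3 * ?c + 2\<close>.\<close>
  moreover have "[:-1, 1:] * lag 3 ^ Suc n = [:-2, 1:] * lag 3 ^ Suc n + lag 3 ^ Suc n"
  proof -
    have "[:-1, 1:] = [:-2, 1:] + (1 :: real poly)" by (simp add: one_pCons)
    thus ?thesis by (simp only: distrib_right mult_1_left)
  qed
  ultimately show ?thesis
    by (simp only: fact_functional_add) (simp only: algebra_simps)
qed

text \<open>This is the recurrence for \<open>p\<close> at index \<open>n + 1\<close>, multiplied by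
  the factorial of \<open>n + 2\<close>.\<close>

lemma fact_functional_recurrence_p:
  "2 * fact_functional (lag 3 ^ Suc (Suc n)) =
     3 * (real n + 2)\<^sup>2 * fact_functional ([:-1, 1:] * lag 3 ^ Suc n)
     - 2 * (3 * real n + 4) * (real n + 2) * fact_functional (lag 3 ^ Suc n)
     + 2 * (real n + 1) * (real n + 2) * fact_functional (lag 3 ^ n)"
proof -
  define c where "c = real (Suc n)"
  define e where "e = c + 1"
  \<comment> \<open>Dividing the recurrence, written as \<open>g - g'\<close>, by \<open>lag 3 ^ n\<close> and comparing
    coefficients determines \<open>g = r * lag 3 ^ Suc n\<close>.\<close>
  define r where "r = smult 2 (lag 3) + smult e (smult 2 (pderiv (lag 3)) - [:0, 1:])"
  have r: "r = [:2 * e, 2 - 5 * e, e - 2, 1/3:]"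
    by (simp add: r_def lag_def pderiv_pCons algebra_simps)
  have id: "r * lag 3 + smult (3 * e\<^sup>2) ([:-1, 1:] * lag 3) + smult (2 * c * e) 1 =
      (pderiv r * lag 3 + smult c (r * pderiv (lag 3))) +
      smult 2 (lag 3 * lag 3) + smult (2 * (3 * c + 1) * e) (lag 3)"
    unfolding r by (simp add: lag_def e_def pderiv_pCons one_pCons field_simps power2_eq_square)
  have "r * lag 3 ^ Suc n + smult (3 * e\<^sup>2) ([:-1, 1:] * lag 3 ^ Suc n) + smult (2 * c * e) (lag 3 ^ n) =
      (pderiv r * lag 3 + smult c (r * pderiv (lag 3))) * lag 3 ^ n +
      smult 2 (lag 3 ^ Suc (Suc n)) + smult (2 * (3 * c + 1) * e) (lag 3 ^ Suc n)"
    using arg_cong[OF id, of "\<lambda>u. u * lag 3 ^ n"]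
    by (simp only: distrib_right mult_smult_left power_Suc mult.assoc mult_1_left)
  from arg_cong[OF this, of fact_functional]
  have "fact_functional (r * lag 3 ^ Suc n) +
      3 * e\<^sup>2 * fact_functional ([:-1, 1:] * lag 3 ^ Suc n) + 2 * c * e * fact_functional (lag 3 ^ n) =
      fact_functional ((pderiv r * lag 3 + smult c (r * pderiv (lag 3))) * lag 3 ^ n) +
      2 * fact_functional (lag 3 ^ Suc (Suc n)) +
      2 * (3 * c + 1) * e * fact_functional (lag 3 ^ Suc n)"
    by (simp only: fact_functional_add fact_functional_smult)
  moreover have "fact_functional (r * lag 3 ^ Suc n) =
      fact_functional ((pderiv r * lag 3 + smult c (r * pderiv (lag 3))) * lag 3 ^ n)"
    unfolding c_def by (rule fact_functional_pderiv_mult_lag3_power)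
  moreover have "c = real n + 1" "e = real n + 2" "3 * c + 1 = 3 * real n + 4"
    by (simp_all add: c_def e_def)
  ultimately show ?thesis by (simp add: algebra_simps del: power_Suc mult_pCons_left)
qed

theorem theorem3p2:
  fixes p q :: "nat \<Rightarrow> real"
  assumes "p 0 = 1" and "p 1 = 0" and "q 0 = 0"
    and "\<And>n. n \<ge> 1 \<Longrightarrow>
      2 * p (n + 1) = (3 * real n + 3) * q n - 2 * (3 * real n + 1) * p n + 2 * p (n - 1)"
    and "\<And>n. n \<ge> 1 \<Longrightarrow> q n = (3 * real n + 2) * p n + 2 * q (n - 1)"
  shows "\<forall>n. p n = real (card {w \<in> cubic_words n. carlitz w \<and> ordered_word w}) \<and>
             q n = real (card {w \<in> cubic_words0 n. carlitz w \<and> ordered_word w})"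
proof -
  define P where "P = (\<lambda>n. fact_functional (lag 3 ^ n) / fact n)"
  define Q where "Q = (\<lambda>n. fact_functional ([:-1, 1:] * lag 3 ^ n) / fact n)"
  have P0: "P 0 = 1" by (simp add: P_def)
  \<comment> \<open>For \<open>lag 3 = x - x^2 + x^3/6\<close> the value is
    \<open>1 - 2 + 1\<close>.\<close>
  have P1: "P (Suc 0) = 0"
    by (simp add: P_def lag_def fact_functional_def numeral_3_eq_3)
  have Q0: "Q 0 = 0" 
  proof -
    have "fact_functional [:-1, 1:] = 0" by (simp add: fact_functional_def)
    thus ?thesis by (simp add: Q_def del: mult_pCons_left)
  qed
  have QS: "Q (Suc n) = (3 * real (Suc n) + 2) * P (Suc n) + 2 * Q n" for n
  proof -
    define F where "F = (fact n :: real)"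
    define x where "x = real n"
    have pos: "F > 0" "x + 1 > 0" by (auto simp: F_def x_def)
    have facts: "fact (Suc n) = (x + 1) * F"
      by (simp add: F_def x_def algebra_simps)
    show ?thesis
      using fact_functional_recurrence_q[of n] pos
      unfolding P_def Q_def facts F_def[symmetric] of_nat_Suc x_def[symmetric]
      by (simp add: divide_simps del: power_Suc mult_pCons_left)
  qed
  have PS: "2 * P (Suc (Suc n)) =
      (3 * real (Suc n) + 3) * Q (Suc n) - 2 * (3 * real (Suc n) + 1) * P (Suc n) + 2 * P n" for n
  proof -
    define F where "F = (fact n :: real)"
    define x where "x = real n"
    have pos: "F > 0" "x + 1 > 0" "x + 2 > 0" by (auto simp: F_def x_def)
    have facts: "fact (Suc n) = (x + 1) * F" "fact (Suc (Suc n)) = (x + 2) * (x + 1) * F"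
      by (simp_all add: F_def x_def algebra_simps)
    show ?thesis
      using fact_functional_recurrence_p[of n] pos
      unfolding P_def Q_def facts F_def[symmetric] of_nat_Suc x_def[symmetric]
      by (simp add: divide_simps power2_eq_square del: power_Suc mult_pCons_left)
         (simp add: algebra_simps del: power_Suc mult_pCons_left)
  qed
  \<comment> \<open>The recurrence for \<open>p\<close> reaches back two indices, so
    \<open>p (Suc n)\<close> is carried along. Each step settles \<open>q (Suc n)\<close> first, as
    \<open>p (Suc (Suc n))\<close> depends on it.\<close>
  have "p n = P n \<and> q n = Q n \<and> p (Suc n) = P (Suc n)" for n
  proof (induction n)
    case 0
    show ?case using assms(1-3) P0 P1 Q0 by simp
  next
    case (Suc n)
    have "q (Suc n) = Q (Suc n)" using Suc assms(5)[of "Suc n"] QS[of n] by simp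
    moreover have "2 * p (Suc (Suc n)) = 2 * P (Suc (Suc n))"
      using Suc calculation assms(4)[of "Suc n"] PS[of n] by simp
    ultimately show ?case using Suc by simp
  qed
  thus ?thesis
    by (simp add: card_ordered_cubic_words card_ordered_cubic_words0 P_def Q_def)
qed

end
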